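(* Let $C,D$ be two closed convex sets in a real Hilbert space $H$ with $C\cap D\ne\emptyset$. Let $\eta>0$, let $\lambda_t\in(0,2]$ for $t\in\mathbb{N}$ with $\lambda:=\inf_{t\in\mathbb{N}}\lambda_t>0$, and let $\{(y^t,z^t,x^t)\}$ be generated, from an arbitrary initial point $x^0\in H$, by the damped Douglas--Rachford algorithm $$y^{t+1}:=P_C^\eta(x^t),\qquad z^{t+1}:=P_D^\eta(2y^{t+1}-x^t),\qquad x^{t+1}:=x^t+\lambda_t(z^{t+1}-y^{t+1}),\qquad t\in\mathbb{N}.$$ Suppose that the pair of sets $\{C,D\}$ has a bounded Hölder regular intersection. Then $x^t\to\bar x$ in norm for some $\bar x\in C\cap D$ with at least a sublinear rate $O(t^{-\rho})$ for some $\rho>0$. Furthermore, if the pair $\{C,D\}$ has a bounded Hölder regular intersection with uniform exponent $\gamma\in(0,1]$, then there exist $M>0$ and $r\in(0,1)$ such that, for all $t\ge1$, $$\|x^t-\bar x\|\le\begin{cases}M\,t^{-\frac{\gamma}{2(1-\gamma)}}&\text{if }\gamma\in(0,1),\\ M\,r^t&\text{if }\gamma=1.\end{cases}$$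
   Context: For a non-empty closed convex set $A\subseteq H$ and $\eta>0$, $P_A$ denotes the nearest point projection onto $A$, and $P_A^\eta:=\frac{1}{2\eta+1}I+\frac{2\eta}{2\eta+1}P_A$, where $I$ is the identity. $\mathbb{N}=\{0,1,2,\dots\}$; $d(x,A)=\inf_{a\in A}\|x-a\|$. The pair $\{C,D\}$ has a bounded Hölder regular intersection if for each bounded set $K\subseteq H$ there exist $\gamma\in(0,1]$ and $\beta>0$ such that $d(x,C\cap D)\le\beta\left(\max\{d(x,C),d(x,D)\}\right)^\gamma$ for all $x\in K$. If $\gamma$ can be chosen independently of $K$, this holds with uniform exponent $\gamma$. Convergence with rate $O(t^{-\rho})$ means $\|x^t-\bar x\|\le Mt^{-\rho}$ for all $t\ge1$ and some constant $M$. *)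

theory Defs
  imports "HOL-Analysis.Analysis"
begin

text \<open>
  A real Hilbert space is a type of sort \<open>{real_inner, complete_space}\<close>. The library's
  \<open>closest_point\<close> has the same definiens as \<open>nearest_point\<close> below, but its type is restricted to
  \<open>heine_borel\<close> spaces, which excludes infinite-dimensional Hilbert spaces. For a non-empty closed
  convex set in a Hilbert space the nearest point exists and is unique, so that the choice
  operator picks the projection.
\<close>

definition nearest_point :: "'a::{real_inner,complete_space} set \<Rightarrow> 'a \<Rightarrow> 'a" where
  "nearest_point A x = (SOME p. p \<in> A \<and> (\<forall>a\<in>A. dist x p \<le> dist x a))"

definition damped_proj :: "real \<Rightarrow> 'a::{real_inner,complete_space} set \<Rightarrow> 'a \<Rightarrow> 'a" where
  "damped_proj \<eta> A x =
     (1 / (2 * \<eta> + 1)) *\<^sub>R x + (2 * \<eta> / (2 * \<eta> + 1)) *\<^sub>R nearest_point A x"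

text \<open>The values \<open>y 0\<close> and \<open>z 0\<close> are unconstrained and play no role.\<close>

definition damped_DR ::
  "'a::{real_inner,complete_space} set \<Rightarrow> 'a set \<Rightarrow> real \<Rightarrow> (nat \<Rightarrow> real)
     \<Rightarrow> (nat \<Rightarrow> 'a) \<Rightarrow> (nat \<Rightarrow> 'a) \<Rightarrow> (nat \<Rightarrow> 'a) \<Rightarrow> bool" where
  "damped_DR C D \<eta> lam y z x \<longleftrightarrow>
     (\<forall>t. y (Suc t) = damped_proj \<eta> C (x t) \<and>
          z (Suc t) = damped_proj \<eta> D (2 *\<^sub>R y (Suc t) - x t) \<and>
          x (Suc t) = x t + lam t *\<^sub>R (z (Suc t) - y (Suc t)))"

text \<open>
  Note that \<open>0 powr \<gamma> = 0\<close>, as required here for \<open>\<gamma> > 0\<close>. These notions are only meant for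
  pairs with non-empty intersection, since \<open>infdist x {} = 0\<close>.
\<close>

definition holder_regular_on ::
  "'a::{real_inner,complete_space} set \<Rightarrow> 'a set \<Rightarrow> 'a set \<Rightarrow> real \<Rightarrow> bool" where
  "holder_regular_on K C D \<gamma> \<longleftrightarrow>
     (\<exists>\<beta>>0. \<forall>x\<in>K. infdist x (C \<inter> D) \<le> \<beta> * (max (infdist x C) (infdist x D)) powr \<gamma>)"

definition bounded_holder_regular ::
  "'a::{real_inner,complete_space} set \<Rightarrow> 'a set \<Rightarrow> bool" where
  "bounded_holder_regular C D \<longleftrightarrow>
     (\<forall>K. bounded K \<longrightarrow> (\<exists>\<gamma>\<in>{0<..1}. holder_regular_on K C D \<gamma>))"

definition bounded_holder_regular_uniform ::
  "'a::{real_inner,complete_space} set \<Rightarrow> 'a set \<Rightarrow> real \<Rightarrow> bool" where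
  "bounded_holder_regular_uniform C D \<gamma> \<longleftrightarrow>
     \<gamma> \<in> {0<..1} \<and> (\<forall>K. bounded K \<longrightarrow> holder_regular_on K C D \<gamma>)"

definition sublinear_rate ::
  "(nat \<Rightarrow> 'a::real_normed_vector) \<Rightarrow> 'a \<Rightarrow> real \<Rightarrow> bool" where
  "sublinear_rate x l \<rho> \<longleftrightarrow> (\<exists>M. \<forall>t\<ge>1. norm (x t - l) \<le> M * real t powr (- \<rho>))"

end

theory Submission
  imports Defs
begin

text \<open>
  For \<open>w \<in> C \<inter> D\<close>, firm nonexpansiveness of the two damped projections yields
  \<open>\<parallel>x' - w\<parallel>\<^sup>2 \<le> \<parallel>x - w\<parallel>\<^sup>2 - \<kappa> max (d(x,C)) (d(x,D))\<^sup>2\<close> for one step \<open>x \<mapsto> x'\<close> of the algorithm.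
  Hoelder regularity on the bounded orbit turns this into the scalar recursion
  \<open>\<delta>' \<le> \<delta> - k \<delta> powr (1/\<gamma>)\<close> for \<open>\<delta> = d(x, C \<inter> D)\<^sup>2\<close>, whose solutions decay like \<open>t powr (- \<gamma>/(1-\<gamma>))\<close>,
  or geometrically if \<open>\<gamma> = 1\<close>. Fejer monotonicity gives \<open>\<parallel>x t - xbar\<parallel> \<le> 2 d(x t, C \<inter> D)\<close>,
  which transfers the rate to the iterates.
\<close>

section \<open>Nearest points in a Hilbert space\<close>

text \<open>Completeness takes the place of compactness: a minimizing sequence is Cauchy by the
  parallelogram law, because convexity keeps the midpoints of its terms in \<open>A\<close>.\<close>

lemma nearest_point_exists:
  fixes A :: "'a::{real_inner,complete_space} set"
  assumes "closed A" "convex A" "A \<noteq> {}"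
  shows "\<exists>p\<in>A. \<forall>a\<in>A. dist x p \<le> dist x a"
proof -
  define \<delta> where "\<delta> = infdist x A"
  have \<delta>0: "\<delta> \<ge> 0" by (simp add: \<delta>_def infdist_nonneg)
  have "\<exists>a\<in>A. dist x a < \<delta> + 1 / real (Suc n)" for n
  proof (rule ccontr)
    assume "\<not> ?thesis"
    then have "\<delta> + 1 / real (Suc n) \<le> infdist x A"
      unfolding infdist_notempty[OF assms(3)] by (intro cINF_greatest assms(3)) (auto simp: not_less)
    then show False by (simp add: \<delta>_def)
  qed
  then obtain a where aA: "\<And>n. a n \<in> A" and a: "\<And>n. dist x (a n) < \<delta> + 1 / real (Suc n)"
    by metis
  have a_ge: "\<delta> \<le> dist x (a n)" for n
    unfolding \<delta>_def by (rule infdist_le[OF aA])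
  have "(\<lambda>n. \<delta> + 1 / real (Suc n)) \<longlonglongrightarrow> \<delta> + 0"
    by (intro tendsto_add tendsto_const LIMSEQ_Suc[OF lim_1_over_n])
  then have upper: "(\<lambda>n. \<delta> + 1 / real (Suc n)) \<longlonglongrightarrow> \<delta>" by simp
  have lim: "(\<lambda>n. dist x (a n)) \<longlonglongrightarrow> \<delta>"
    by (rule tendsto_sandwich[OF always_eventually always_eventually tendsto_const upper])
      (use a_ge less_imp_le[OF a] in blast)+
  have "Cauchy a"
  proof (rule metric_CauchyI)
    fix e :: real assume e: "e > 0"
    have "(\<lambda>n. (dist x (a n))\<^sup>2) \<longlonglongrightarrow> \<delta>\<^sup>2"
      by (intro tendsto_intros lim)
    moreover have "\<delta>\<^sup>2 < \<delta>\<^sup>2 + e\<^sup>2 / 4"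
      \<comment> \<open>The parallelogram law below weights the two squared distances by 2 each, so
        a slack of a quarter of \<open>e\<close> squared in each adds up to \<open>e\<close>
        squared.\<close>
      using e by simp
    ultimately have "\<forall>\<^sub>F n in sequentially. (dist x (a n))\<^sup>2 < \<delta>\<^sup>2 + e\<^sup>2 / 4"
      by (rule order_tendstoD)
    then obtain N where N: "\<And>n. n \<ge> N \<Longrightarrow> (dist x (a n))\<^sup>2 < \<delta>\<^sup>2 + e\<^sup>2 / 4"
      by (auto simp: eventually_sequentially)
    have "dist (a m) (a n) < e" if mn: "m \<ge> N" "n \<ge> N" for m n
    proof -
      let ?mid = "(1/2) *\<^sub>R a m + (1/2) *\<^sub>R a n"
      have "?mid \<in> A"
        using assms(2) aA by (intro convexD) auto
      then have "\<delta>\<^sup>2 \<le> (dist x ?mid)\<^sup>2"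
        using \<delta>0 unfolding \<delta>_def by (intro power_mono infdist_le)
      moreover have "(dist (a m) (a n))\<^sup>2 =
          2 * (dist x (a m))\<^sup>2 + 2 * (dist x (a n))\<^sup>2 - 4 * (dist x ?mid)\<^sup>2"
        unfolding dist_norm power2_norm_eq_inner
        by (simp add: inner_diff_left inner_diff_right inner_add_left inner_add_right inner_commute field_simps)
      ultimately have "(dist (a m) (a n))\<^sup>2 < e\<^sup>2"
        using N[OF mn(1)] N[OF mn(2)] by linarith
      then show ?thesis
        using e by (simp add: power_less_imp_less_base)
    qed
    then show "\<exists>N. \<forall>m\<ge>N. \<forall>n\<ge>N. dist (a m) (a n) < e" by blast
  qed
  then obtain p where p: "a \<longlonglongrightarrow> p"
    using Cauchy_convergent convergent_def by blast
  have "p \<in> A"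
    using assms(1) aA p closed_sequentially by blast
  moreover have "dist x p = \<delta>"
    using LIMSEQ_unique[OF tendsto_dist[OF tendsto_const p] lim] .
  ultimately show ?thesis
    unfolding \<delta>_def by (intro bexI[of _ p]) (auto intro: infdist_le)
qed

lemma
  fixes A :: "'a::{real_inner,complete_space} set"
  assumes "closed A" "convex A" "A \<noteq> {}"
  shows nearest_point_in: "nearest_point A x \<in> A"
    and nearest_point_le: "w \<in> A \<Longrightarrow> dist x (nearest_point A x) \<le> dist x w"
proof -
  have "nearest_point A x \<in> A \<and> (\<forall>w\<in>A. dist x (nearest_point A x) \<le> dist x w)"
    unfolding nearest_point_def
    by (rule someI_ex) (use nearest_point_exists[OF assms, of x] in blast)
  then show "nearest_point A x \<in> A"
    and "w \<in> A \<Longrightarrow> dist x (nearest_point A x) \<le> dist x w" by auto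
qed

lemma infdist_eq_dist_nearest_point:
  fixes A :: "'a::{real_inner,complete_space} set"
  assumes "closed A" "convex A" "A \<noteq> {}"
  shows "infdist x A = dist x (nearest_point A x)"
  unfolding infdist_notempty[OF assms(3)]
proof (rule antisym)
  show "(INF a\<in>A. dist x a) \<le> dist x (nearest_point A x)"
    by (rule cINF_lower[OF bdd_belowI2[of _ 0] nearest_point_in[OF assms]]) simp
  show "dist x (nearest_point A x) \<le> (INF a\<in>A. dist x a)"
    by (rule cINF_greatest[OF assms(3) nearest_point_le[OF assms]])
qed

section \<open>Damped projections and one step of the algorithm\<close>

text \<open>\<open>damped_proj \<eta> A\<close> is the resolvent of \<open>2\<eta>(I - P\<^sub>A)\<close>, and \<open>a\<close> is the projection of both \<open>x\<close> and \<open>p\<close>.\<close>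

lemma damped_proj_resolvent:
  fixes A :: "'a::{real_inner,complete_space} set" and x :: 'a
  assumes "closed A" "convex A" "A \<noteq> {}" "\<eta> > 0"
  defines "p \<equiv> damped_proj \<eta> A x"
  shows "\<exists>a\<in>A. x - p = (2 * \<eta>) *\<^sub>R (p - a) \<and>
    (\<forall>w\<in>A. (norm (p - a))\<^sup>2 \<le> inner (p - a) (p - w))"
proof (intro bexI conjI ballI)
  define a where "a = nearest_point A x"
  show aA: "a \<in> A"
    unfolding a_def by (rule nearest_point_in[OF assms(1-3)])
  have pos: "2 * \<eta> + 1 > 0" using assms(4) by simp
  have coeff: "2 * \<eta> / (2 * \<eta> + 1) = 1 - 1 / (2 * \<eta> + 1)"
    using pos by (simp add: field_simps)
  have pa: "p - a = (1 / (2 * \<eta> + 1)) *\<^sub>R (x - a)"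
    unfolding p_def damped_proj_def a_def[symmetric] coeff by (simp add: algebra_simps)
  have "x - a = (2 * \<eta> + 1) *\<^sub>R (p - a)"
    unfolding pa using pos by simp
  then show "x - p = (2 * \<eta>) *\<^sub>R (p - a)"
    by (simp add: algebra_simps)
  fix w assume w: "w \<in> A"
  \<comment> \<open>The variational inequality of the projection; adding
    \<open>inner (p - a) (w - a) \<le> 0\<close> to \<open>inner (p - a) (p - w)\<close> gives the
    squared norm of \<open>p - a\<close> as a lower bound.\<close>
  have "inner (x - a) (w - a) \<le> 0"
    using nearest_point_le[OF assms(1-3), of _ x] w aA
    by (intro any_closest_point_dot[of A]) (use assms in \<open>auto simp: a_def\<close>)
  then have "inner (p - a) (w - a) \<le> 0"
    unfolding pa using pos by (simp add: divide_nonpos_pos)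
  then show "(norm (p - a))\<^sup>2 \<le> inner (p - a) (p - w)"
    unfolding power2_norm_eq_inner by (simp add: inner_diff_right)
qed

text \<open>The resolvent inequalities at \<open>x\<close> and at the reflected point
  \<open>2 *\<^sub>R y - x\<close> bound the decrease below by the squared residuals
  \<open>y - c\<close> and \<open>z - d\<close>. Conversely, \<open>x - c\<close> and
  \<open>x - d\<close> are combinations of these residuals, so the residuals control both
  distances.\<close>

lemma damped_DR_step:
  fixes C D :: "'a::{real_inner,complete_space} set"
  assumes C: "closed C" "convex C" and D: "closed D" "convex D"
    and \<eta>: "\<eta> > 0" and l: "0 < l" "l \<le> 2" and w: "w \<in> C \<inter> D"
    and y: "y = damped_proj \<eta> C x" and z: "z = damped_proj \<eta> D (2 *\<^sub>R y - x)"
  shows "(dist (x + l *\<^sub>R (z - y)) w)\<^sup>2 \<le>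
    (dist x w)\<^sup>2 - (2 * \<eta> * l / (4 * \<eta> + 1)\<^sup>2) * (max (infdist x C) (infdist x D))\<^sup>2"
proof -
  have wC: "w \<in> C" and wD: "w \<in> D" using w by auto
  then have ne: "C \<noteq> {}" "D \<noteq> {}" by auto
  obtain c where c: "c \<in> C" "x - y = (2 * \<eta>) *\<^sub>R (y - c)"
    and yc: "(norm (y - c))\<^sup>2 \<le> inner (y - c) (y - w)"
    using damped_proj_resolvent[OF C ne(1) \<eta>, of x] wC unfolding y[symmetric] by blast
  obtain d where d: "d \<in> D" "(2 *\<^sub>R y - x) - z = (2 * \<eta>) *\<^sub>R (z - d)"
    and zd: "(norm (z - d))\<^sup>2 \<le> inner (z - d) (z - w)"
    using damped_proj_resolvent[OF D ne(2) \<eta>, of "2 *\<^sub>R y - x"] wD unfolding z[symmetric] by blast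
  \<comment> \<open>\<open>u\<close> and \<open>v\<close> are the displacements of the two
    resolvents, and \<open>u + v = y - z\<close>, so the step subtracts \<open>l\<close> times
    \<open>u + v\<close> from \<open>x\<close>.\<close>
  define u where "u = x - y"
  define v where "v = (2 *\<^sub>R y - x) - z"
  define m where "m = max (infdist x C) (infdist x D)"
  let ?a = "norm (y - c)" and ?b = "norm (z - d)"
  have id: "(dist (x + l *\<^sub>R (z - y)) w)\<^sup>2 =
      (dist x w)\<^sup>2 - 2 * l * (inner u (y - w) + inner v (z - w)) - l * (2 - l) * (norm (u + v))\<^sup>2"
  proof -
    define p where "p = x - w"
    define q where "q = u + v"
    have eqs: "x + l *\<^sub>R (z - y) - w = p - l *\<^sub>R q" "y - w = p - u" "z - w = p - u - q" "v = q - u"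
      by (auto simp: p_def q_def u_def v_def algebra_simps scaleR_2)
    have combine: "inner u (p - u) + inner v (p - u - q) = inner p q - inner q q"
      unfolding eqs(4) by (simp add: inner_diff_left inner_diff_right inner_commute)
    have expand: "inner (p - l *\<^sub>R q) (p - l *\<^sub>R q) = inner p p - 2 * l * inner p q + l * l * inner q q"
      by (simp add: inner_diff_left inner_diff_right inner_commute)
    show ?thesis
      unfolding dist_norm power2_norm_eq_inner eqs(1-3) p_def[symmetric] q_def[symmetric]
        combine expand
      by (simp add: algebra_simps)
  qed
  have "2 * \<eta> * ?a\<^sup>2 \<le> inner u (y - w)"
    unfolding u_def c(2) using yc \<eta> by (simp add: mult_left_mono)
  moreover have "2 * \<eta> * ?b\<^sup>2 \<le> inner v (z - w)"
    unfolding v_def d(2) using zd \<eta> by (simp add: mult_left_mono)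
  ultimately have "2 * l * (2 * \<eta> * (?a\<^sup>2 + ?b\<^sup>2)) \<le> 2 * l * (inner u (y - w) + inner v (z - w))"
    using l by (intro mult_left_mono) (auto simp: distrib_left)
  \<comment> \<open>The bound \<open>l \<le> 2\<close> lets the last term of the identity be
    dropped.\<close>
  moreover have "0 \<le> l * (2 - l) * (norm (u + v))\<^sup>2"
    using l by simp
  ultimately have descent: "(dist (x + l *\<^sub>R (z - y)) w)\<^sup>2 \<le>
      (dist x w)\<^sup>2 - 4 * \<eta> * l * (?a\<^sup>2 + ?b\<^sup>2)"
    unfolding id by (simp add: algebra_simps)
  have "infdist x C \<le> norm (x - c)"
    using infdist_le[OF c(1), of x] by (simp add: dist_norm)
  also have "x - c = (2 * \<eta> + 1) *\<^sub>R (y - c)"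
    using c(2) by (simp add: algebra_simps)
  also have "norm \<dots> = (2 * \<eta> + 1) * ?a"
    using \<eta> by simp
  also have "\<dots> \<le> (4 * \<eta> + 1) * (?a + ?b)"
    using \<eta> by (intro mult_mono) auto
  finally have mC: "infdist x C \<le> (4 * \<eta> + 1) * (?a + ?b)" .
  have "infdist x D \<le> norm (x - d)"
    using infdist_le[OF d(1), of x] by (simp add: dist_norm)
  \<comment> \<open>The second resolvent starts at the reflected point, so the path from
    \<open>x\<close> to \<open>d\<close> runs through it; the extra
    \<open>2 *\<^sub>R (x - y)\<close> brings in the coefficient \<open>4 * \<eta>\<close> and hence
    the common constant \<open>4 * \<eta> + 1\<close>.\<close>
  also have "x - d = 2 *\<^sub>R (x - y) + ((2 *\<^sub>R y - x) - z) + (z - d)"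
    by (simp add: algebra_simps scaleR_2)
  also have "\<dots> = (4 * \<eta>) *\<^sub>R (y - c) + (2 * \<eta> + 1) *\<^sub>R (z - d)"
    unfolding c(2) d(2) by (simp add: algebra_simps)
  also have "norm \<dots> \<le> 4 * \<eta> * ?a + (2 * \<eta> + 1) * ?b"
    using \<eta> by (intro norm_triangle_le) simp
  also have "\<dots> \<le> (4 * \<eta> + 1) * ?a + (4 * \<eta> + 1) * ?b"
    using \<eta> by (intro add_mono mult_right_mono) auto
  finally have "m \<le> (4 * \<eta> + 1) * (?a + ?b)"
    using mC by (simp add: m_def distrib_left)
  then have "m\<^sup>2 \<le> ((4 * \<eta> + 1) * (?a + ?b))\<^sup>2"
    by (intro power_mono) (auto simp: m_def infdist_nonneg le_max_iff_disj)
  also have "\<dots> \<le> (4 * \<eta> + 1)\<^sup>2 * (2 * (?a\<^sup>2 + ?b\<^sup>2))"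
    unfolding power_mult_distrib
    using sum_squares_bound[of ?a ?b] by (intro mult_left_mono zero_le_power2) (simp add: power2_sum)
  finally have "m\<^sup>2 / (4 * \<eta> + 1)\<^sup>2 \<le> 2 * (?a\<^sup>2 + ?b\<^sup>2)"
    using \<eta> by (simp add: field_simps)
  then have "2 * \<eta> * l * (m\<^sup>2 / (4 * \<eta> + 1)\<^sup>2) \<le> 2 * \<eta> * l * (2 * (?a\<^sup>2 + ?b\<^sup>2))"
    using \<eta> l by (intro mult_left_mono) auto
  with descent show ?thesis
    unfolding m_def[symmetric] by (simp add: algebra_simps)
qed

section \<open>Fejer monotone sequences\<close>

lemma dist_Fejer_mono:
  fixes x :: "nat \<Rightarrow> 'a::metric_space"
  assumes "\<And>t. dist (x (Suc t)) w \<le> dist (x t) w" "s \<le> t"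
  shows "dist (x t) w \<le> dist (x s) w"
  using lift_Suc_antimono_le[of "\<lambda>t. dist (x t) w", OF assms] .

text \<open>After time \<open>s\<close> the orbit stays in every ball centred at a point of
  \<open>S\<close> with \<open>x s\<close> on its boundary. Taking the infimum over the centres
  bounds all later displacements from \<open>x s\<close> by \<open>2 * infdist (x s) S\<close>,
  which yields both the Cauchy property and the error estimate.\<close>

lemma Fejer_monotone_limit:
  fixes x :: "nat \<Rightarrow> 'a::complete_space"
  assumes S: "closed S" "S \<noteq> {}"
    and mono: "\<And>w t. w \<in> S \<Longrightarrow> dist (x (Suc t)) w \<le> dist (x t) w"
    and lim: "(\<lambda>t. infdist (x t) S) \<longlonglongrightarrow> 0"
  obtains l where "l \<in> S" "x \<longlonglongrightarrow> l" "\<And>t. dist (x t) l \<le> 2 * infdist (x t) S"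
proof -
  have close: "dist (x t) (x s) \<le> 2 * infdist (x s) S" if st: "s \<le> t" for s t
  proof -
    have "dist (x t) (x s) / 2 \<le> infdist (x s) S"
      unfolding infdist_notempty[OF S(2)]
    proof (intro cINF_greatest S(2))
      fix w assume w: "w \<in> S"
      have "dist (x t) (x s) \<le> dist (x t) w + dist (x s) w"
        by (rule dist_triangle2)
      with dist_Fejer_mono[of x w, OF mono[OF w] st] show "dist (x t) (x s) / 2 \<le> dist (x s) w"
        by simp
    qed
    then show ?thesis by simp
  qed
  have "Cauchy x"
  proof (rule metric_CauchyI)
    fix e :: real assume e: "e > 0"
    then have "\<forall>\<^sub>F t in sequentially. infdist (x t) S < e / 4"
      using order_tendstoD(2)[OF lim, of "e / 4"] by simp
    then obtain N where "infdist (x N) S < e / 4"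
      by (auto simp: eventually_sequentially)
    then have N: "dist (x t) (x N) < e / 2" if "t \<ge> N" for t
      using close[OF that] by simp
    have "dist (x m) (x n) < e" if "m \<ge> N" "n \<ge> N" for m n
      using N[OF that(1)] N[OF that(2)] dist_triangle2[of "x m" "x n" "x N"] by simp
    then show "\<exists>N. \<forall>m\<ge>N. \<forall>n\<ge>N. dist (x m) (x n) < e" by blast
  qed
  then obtain l where l: "x \<longlonglongrightarrow> l"
    using Cauchy_convergent convergent_def by blast
  have "infdist l S = 0"
    using LIMSEQ_unique[OF tendsto_infdist[OF l] lim] .
  then have "l \<in> S"
    using in_closed_iff_infdist_zero[OF S] by simp
  moreover have "dist (x t) l \<le> 2 * infdist (x t) S" for t
  proof -
    have "dist l (x t) \<le> 2 * infdist (x t) S"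
      by (rule LIMSEQ_le_const2[OF tendsto_dist[OF l tendsto_const]]) (use close in blast)
    then show ?thesis by (simp add: dist_commute)
  qed
  ultimately show ?thesis using that l by blast
qed

section \<open>Rates for scalar recursions\<close>

text \<open>A discrete form of the differential inequality
  \<open>\<delta>' \<le> - k \<delta> powr (1 + p)\<close>: the quantity
  \<open>\<delta> powr (- p)\<close> grows by at least \<open>p * k\<close> in each step.\<close>

lemma powr_recursion_rate:
  fixes \<delta> :: "nat \<Rightarrow> real"
  assumes p: "p > 0" and k: "k > 0" and nonneg: "\<And>t. \<delta> t \<ge> 0"
    and step: "\<And>t. \<delta> (Suc t) \<le> \<delta> t - k * \<delta> t powr (1 + p)"
    and t: "t \<ge> 1"
  shows "\<delta> t \<le> (p * k * real t) powr (- (1 / p))"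
proof (cases "\<delta> t = 0")
  case False
  have anti: "\<delta> (Suc s) \<le> \<delta> s" for s
    using step[of s] k by (smt (verit) mult_nonneg_nonneg powr_ge_zero)
  \<comment> \<open>Since \<open>\<delta> t > 0\<close> and \<open>\<delta>\<close> decreases, all
    terms up to \<open>t\<close> are positive. This matters because
    \<open>0 powr (- p) = 0\<close>.\<close>
  have lower: "p * k * real s \<le> \<delta> s powr (- p)" if "s \<le> t" for s
    using that
  proof (induction s)
    case (Suc s)
    have pos': "\<delta> (Suc s) > 0"
      using lift_Suc_antimono_le[of \<delta>, OF anti Suc.prems] False nonneg[of t] by simp
    then have pos: "\<delta> s > 0" using anti[of s] by simp
    \<comment> \<open>\<open>e\<close> is the guaranteed relative decrease. Positivity of the next
      term forces \<open>e < 1\<close>, so the Bernoulli-type bound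
      \<open>1 + p * e \<le> (1 - e) powr (- p)\<close> applies.\<close>
    define e where "e = k * \<delta> s powr p"
    have "\<delta> (Suc s) \<le> \<delta> s * (1 - e)"
      using step[of s] pos by (simp add: e_def powr_add algebra_simps)
    then have "0 < \<delta> s * (1 - e)" using pos' by linarith
    then have e1: "0 < 1 - e" using pos by (simp add: zero_less_mult_iff)
    have "1 + p * e \<le> exp (p * e)" by (rule exp_ge_add_one_self)
    also have "\<dots> \<le> exp (- p * ln (1 - e))"
      using mult_left_mono[of e "- ln (1 - e)" p] ln_le_minus_one[OF e1] p by simp
    also have "\<dots> = (1 - e) powr (- p)"
      using e1 by (simp add: powr_def)
    finally have "(1 + p * e) * \<delta> s powr (- p) \<le> (1 - e) powr (- p) * \<delta> s powr (- p)"
      by (intro mult_right_mono) auto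
    also have "\<dots> = (\<delta> s * (1 - e)) powr (- p)"
      using pos e1 by (simp add: powr_mult mult.commute)
    also have "\<dots> \<le> \<delta> (Suc s) powr (- p)"
      using \<open>\<delta> (Suc s) \<le> \<delta> s * (1 - e)\<close> pos' p by (intro powr_mono2') auto
    finally have "(1 + p * e) * \<delta> s powr (- p) \<le> \<delta> (Suc s) powr (- p)" .
    moreover have "e * \<delta> s powr (- p) = k"
      using pos by (simp add: e_def powr_minus)
    then have "(1 + p * e) * \<delta> s powr (- p) = \<delta> s powr (- p) + p * k"
      by (simp add: distrib_right mult.assoc)
    moreover have "p * k * real (Suc s) = p * k * real s + p * k"
      by (simp add: algebra_simps)
    ultimately show ?case
      using Suc by linarith
  qed simp
  have pos: "\<delta> t > 0" using False nonneg[of t] by simp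
  have "(\<delta> t powr (- p)) powr (- (1 / p)) \<le> (p * k * real t) powr (- (1 / p))"
    using lower[of t] p k t by (intro powr_mono2') auto
  then show ?thesis
    using p pos by (simp add: powr_powr)
qed simp

text \<open>Inverting the Hoelder bound gives a lower bound for the decrease in terms of
  \<open>d\<close> alone: a recursion for the square of \<open>d\<close> with exponent
  \<open>1 / \<gamma>\<close>, which is linear exactly when \<open>\<gamma> = 1\<close>.\<close>

lemma Hoelder_descent_rate:
  fixes d m :: "nat \<Rightarrow> real"
  assumes \<kappa>: "\<kappa> > 0" and \<beta>: "\<beta> > 0" and \<gamma>: "\<gamma> \<in> {0<..1}"
    and d: "\<And>t. d t \<ge> 0" and m: "\<And>t. m t \<ge> 0"
    and step: "\<And>t. (d (Suc t))\<^sup>2 \<le> (d t)\<^sup>2 - \<kappa> * (m t)\<^sup>2"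
    and hoelder: "\<And>t. d t \<le> \<beta> * m t powr \<gamma>"
  shows "\<exists>M>0. \<exists>r\<in>{0<..<1}. \<forall>t\<ge>1.
    d t \<le> (if \<gamma> < 1 then M * real t powr (- (\<gamma> / (2 * (1 - \<gamma>)))) else M * r ^ t)"
proof -
  define k where "k = \<kappa> / (\<beta>\<^sup>2) powr (1 / \<gamma>)"
  have k: "k > 0" using \<kappa> \<beta> by (simp add: k_def)
  have rec: "(d (Suc t))\<^sup>2 \<le> (d t)\<^sup>2 - k * ((d t)\<^sup>2) powr (1 / \<gamma>)" for t
  proof -
    have "((d t)\<^sup>2) powr (1 / \<gamma>) \<le> ((\<beta> * m t powr \<gamma>)\<^sup>2) powr (1 / \<gamma>)"
      using \<gamma> d[of t] hoelder[of t] by (intro powr_mono2 power_mono) auto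
    also have "\<dots> = (\<beta>\<^sup>2) powr (1 / \<gamma>) * ((m t powr \<gamma>) powr (1 / \<gamma>))\<^sup>2"
      by (simp add: power_mult_distrib powr_mult power2_eq_square)
    also have "(m t powr \<gamma>) powr (1 / \<gamma>) = m t"
      using \<gamma> m[of t] by (simp add: powr_powr)
    finally have "k * ((d t)\<^sup>2) powr (1 / \<gamma>) \<le> \<kappa> * (m t)\<^sup>2"
      using \<kappa> \<beta> unfolding k_def by (simp add: field_simps)
    then show ?thesis using step[of t] by linarith
  qed
  show ?thesis
  proof (cases "\<gamma> < 1")
    case True
    define p where "p = 1 / \<gamma> - 1"
    have p: "p > 0" and p1: "1 / \<gamma> = 1 + p" using True \<gamma> by (auto simp: p_def)
    \<comment> \<open>The recursion controls the square of \<open>d\<close>, so the exponent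
      \<open>1 / p = \<gamma> / (1 - \<gamma>)\<close> is halved for \<open>d\<close>.\<close>
    have e: "1 / p / 2 = \<gamma> / (2 * (1 - \<gamma>))"
      using True \<gamma> by (simp add: p_def field_simps)
    define M where "M = (p * k) powr (- (\<gamma> / (2 * (1 - \<gamma>))))"
    have "d t \<le> M * real t powr (- (\<gamma> / (2 * (1 - \<gamma>))))" if t: "t \<ge> 1" for t
    proof -
      have "(d t)\<^sup>2 \<le> (p * k * real t) powr (- (1 / p))"
        by (rule powr_recursion_rate[of p k "\<lambda>t. (d t)\<^sup>2", OF p k _ _ t])
          (use rec p1 in auto)
      also have "\<dots> = ((p * k * real t) powr (- (1 / p / 2)))\<^sup>2"
        by (simp add: power2_eq_square flip: powr_add)
      finally have "d t \<le> (p * k * real t) powr (- (1 / p / 2))"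
        by (rule power2_le_imp_le) simp
      also have "\<dots> = M * real t powr (- (\<gamma> / (2 * (1 - \<gamma>))))"
        unfolding e M_def using p k by (simp add: powr_mult)
      finally show ?thesis .
    qed
    moreover have "M > 0" using p k by (simp add: M_def)
    ultimately show ?thesis
      using True by (intro exI[of _ M] conjI bexI[of _ "1/2"]) auto
  next
    case False
    then have \<gamma>1: "\<gamma> = 1" using \<gamma> by auto
    \<comment> \<open>The maximum with \<open>1/2\<close> keeps the ratio positive even if
      \<open>k \<ge> 1\<close>.\<close>
    define q where "q = max (1/2) (1 - k)"
    have q: "0 < q" "q < 1" using k by (auto simp: q_def)
    have geo: "(d t)\<^sup>2 \<le> q ^ t * (d 0)\<^sup>2" for t
    proof (induction t)
      case (Suc t)
      have "(d (Suc t))\<^sup>2 \<le> (1 - k) * (d t)\<^sup>2"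
        using rec[of t] by (simp add: \<gamma>1 algebra_simps)
      also have "\<dots> \<le> q * (d t)\<^sup>2"
        by (intro mult_right_mono) (auto simp: q_def)
      also have "\<dots> \<le> q * (q ^ t * (d 0)\<^sup>2)"
        using Suc q by (intro mult_left_mono) auto
      finally show ?case by simp
    qed simp
    \<comment> \<open>Adding 1 makes the constant positive even if \<open>d 0 = 0\<close>.\<close>
    have "d t \<le> (d 0 + 1) * sqrt q ^ t" for t
    proof -
      have sq: "(sqrt q ^ t)\<^sup>2 = q ^ t"
        using q by (simp add: power2_eq_square flip: power_mult_distrib)
      have "(d t)\<^sup>2 \<le> (sqrt q ^ t * d 0)\<^sup>2"
        unfolding power_mult_distrib sq using geo[of t] .
      then have "d t \<le> sqrt q ^ t * d 0"
        using q d by (intro power2_le_imp_le[of "d t"]) auto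
      also have "\<dots> \<le> (d 0 + 1) * sqrt q ^ t"
        using q by (simp add: algebra_simps)
      finally show ?thesis .
    qed
    moreover have "d 0 + 1 > 0" using d[of 0] by linarith
    ultimately show ?thesis
      using q False by (intro exI[of _ "d 0 + 1"] conjI bexI[of _ "sqrt q"]) auto
  qed
qed

lemma geometric_le_inverse:
  fixes r :: real
  assumes "0 < r" "r < 1"
  obtains K where "K > 0" "\<And>t. t \<ge> 1 \<Longrightarrow> r ^ t \<le> K * real t powr (- 1)"
proof -
  have "(\<lambda>t. real t * r ^ t) \<longlonglongrightarrow> 0"
    using assms by (intro powser_times_n_limit_0) auto
  then have "Bseq (\<lambda>t. real t * r ^ t)"
    using convergentI convergent_imp_Bseq by blast
  then obtain K where K: "K > 0" "\<And>t. norm (real t * r ^ t) \<le> K"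
    by (auto simp: Bseq_def)
  have "r ^ t \<le> K * real t powr (- 1)" if t: "t \<ge> 1" for t
    using K(2)[of t] t assms by (simp add: powr_minus field_simps)
  with K(1) that show ?thesis by blast
qed

text \<open>Both cases provide a sublinear rate: geometric decay is weakened to the power
  \<open>- 1\<close>, using that \<open>real t * r ^ t\<close> is bounded.\<close>

lemma rate_imp_powr_rate:
  fixes d :: "nat \<Rightarrow> real"
  assumes \<gamma>: "\<gamma> \<in> {0<..1}"
    and "\<exists>M>0. \<exists>r\<in>{0<..<1}. \<forall>t\<ge>1.
      d t \<le> (if \<gamma> < 1 then M * real t powr (- (\<gamma> / (2 * (1 - \<gamma>)))) else M * r ^ t)"
  obtains \<rho> M where "\<rho> > 0" "M > 0" "\<And>t. t \<ge> 1 \<Longrightarrow> d t \<le> M * real t powr (- \<rho>)"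
proof -
  obtain M r where M: "M > 0" and r: "0 < r" "r < 1"
    and b: "\<And>t. t \<ge> 1 \<Longrightarrow>
      d t \<le> (if \<gamma> < 1 then M * real t powr (- (\<gamma> / (2 * (1 - \<gamma>)))) else M * r ^ t)"
    using assms(2) by auto
  show ?thesis
  proof (cases "\<gamma> < 1")
    case True
    then show ?thesis
      using that[of "\<gamma> / (2 * (1 - \<gamma>))" M] M b \<gamma> by simp
  next
    case False
    obtain K where K: "K > 0" "\<And>t. t \<ge> 1 \<Longrightarrow> r ^ t \<le> K * real t powr (- 1)"
      using geometric_le_inverse[OF r] by blast
    have "d t \<le> M * K * real t powr (- 1)" if t: "t \<ge> 1" for t
    proof -
      have "d t \<le> M * r ^ t" using b[OF t] False by simp
      also have "\<dots> \<le> M * (K * real t powr (- 1))"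
        using K(2)[OF t] M by (intro mult_left_mono) auto
      finally show ?thesis by (simp add: mult.assoc)
    qed
    then show ?thesis using that[of 1 "M * K"] M K(1) by simp
  qed
qed


section \<open>Convergence of the iterates and its rates\<close>

theorem theorem5p2:
  fixes C D :: "'a::{real_inner,complete_space} set"
    and \<eta> :: real
    and lam :: "nat \<Rightarrow> real"
    and x y z :: "nat \<Rightarrow> 'a"
  assumes "closed C" "convex C" "closed D" "convex D"
    and "C \<inter> D \<noteq> {}"
    and "\<eta> > 0"
    and "\<And>t. lam t \<in> {0<..2}"
    and "(INF t. lam t) > 0"
    and "damped_DR C D \<eta> lam y z x"
    and "bounded_holder_regular C D"
  shows "\<exists>xbar \<in> C \<inter> D.
    x \<longlonglongrightarrow> xbar \<and>
    (\<exists>\<rho>>0. sublinear_rate x xbar \<rho>) \<and>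
    (\<forall>\<gamma>. bounded_holder_regular_uniform C D \<gamma> \<longrightarrow>
      (\<exists>M>0. \<exists>r\<in>{0<..<1}. \<forall>t\<ge>1.
         norm (x t - xbar) \<le>
           (if \<gamma> < 1 then M * real t powr (- (\<gamma> / (2 * (1 - \<gamma>)))) else M * r ^ t)))"
proof -
  define S where "S = C \<inter> D"
  have S: "closed S" "convex S" "S \<noteq> {}"
    using assms(1-5) by (auto simp: S_def convex_Int)
  define d where "d t = infdist (x t) S" for t
  define m where "m t = max (infdist (x t) C) (infdist (x t) D)" for t
  \<comment> \<open>Replacing \<open>lam t\<close> by its infimum makes the descent constant
    \<open>\<kappa>\<close> independent of \<open>t\<close>.\<close>
  define l where "l = (INF t. lam t)"
  define \<kappa> where "\<kappa> = 2 * \<eta> * l / (4 * \<eta> + 1)\<^sup>2"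
  have \<kappa>: "\<kappa> > 0"
    using assms(6,8) by (simp add: \<kappa>_def l_def)
  have lam: "0 < lam t" "lam t \<le> 2" for t
    using assms(7)[of t] by auto
  have l_le: "l \<le> lam t" for t
    unfolding l_def by (rule cINF_lower) (auto intro!: bdd_belowI2[of _ 0] less_imp_le lam)
  have d0: "d t \<ge> 0" and m0: "m t \<ge> 0" for t
    by (auto simp: d_def m_def infdist_nonneg le_max_iff_disj)
  have descent: "(dist (x (Suc t)) w)\<^sup>2 \<le> (dist (x t) w)\<^sup>2 - \<kappa> * (m t)\<^sup>2" if w: "w \<in> S" for w t
  proof -
    have "(dist (x (Suc t)) w)\<^sup>2 \<le>
        (dist (x t) w)\<^sup>2 - (2 * \<eta> * lam t / (4 * \<eta> + 1)\<^sup>2) * (m t)\<^sup>2"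
      using damped_DR_step[OF assms(1-4,6) lam, of w "y (Suc t)" "x t" "z (Suc t)" t]
        assms(9) w unfolding damped_DR_def m_def S_def by metis
    moreover have "\<kappa> * (m t)\<^sup>2 \<le> (2 * \<eta> * lam t / (4 * \<eta> + 1)\<^sup>2) * (m t)\<^sup>2"
      unfolding \<kappa>_def using l_le[of t] assms(6)
      by (intro mult_right_mono divide_right_mono mult_left_mono) auto
    ultimately show ?thesis by linarith
  qed
  have fejer: "dist (x (Suc t)) w \<le> dist (x t) w" if w: "w \<in> S" for w t
  proof (rule power2_le_imp_le)
    show "(dist (x (Suc t)) w)\<^sup>2 \<le> (dist (x t) w)\<^sup>2"
      using descent[OF w, of t] \<kappa> by (smt (verit) mult_nonneg_nonneg zero_le_power2)
  qed simp
  have d_step: "(d (Suc t))\<^sup>2 \<le> (d t)\<^sup>2 - \<kappa> * (m t)\<^sup>2" for t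
  proof -
    \<comment> \<open>With the projection of \<open>x t\<close> as reference point, the right-hand
      distance is exactly \<open>d t\<close>, while the left-hand one is at least
      \<open>d (Suc t)\<close>.\<close>
    let ?w = "nearest_point S (x t)"
    have w: "?w \<in> S" by (rule nearest_point_in[OF S])
    have "(d (Suc t))\<^sup>2 \<le> (dist (x (Suc t)) ?w)\<^sup>2"
      using d0 w unfolding d_def by (intro power_mono infdist_le)
    then show ?thesis
      using descent[OF w, of t] infdist_eq_dist_nearest_point[OF S, of "x t"] by (simp add: d_def)
  qed
  \<comment> \<open>The orbit itself serves as the bounded set on which regularity is
    invoked.\<close>
  have bdd: "bounded (range x)"
  proof -
    obtain w where w: "w \<in> S" using S(3) by blast
    have "dist w (x t) \<le> dist (x 0) w" for t
      using dist_Fejer_mono[of x w, OF fejer[OF w], of 0 t] by (simp add: dist_commute)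
    then show ?thesis unfolding bounded_def by blast
  qed
  have rate: "\<exists>M>0. \<exists>r\<in>{0<..<1}. \<forall>t\<ge>1.
      d t \<le> (if \<gamma> < 1 then M * real t powr (- (\<gamma> / (2 * (1 - \<gamma>)))) else M * r ^ t)"
    if \<gamma>: "\<gamma> \<in> {0<..1}" and regular: "holder_regular_on (range x) C D \<gamma>" for \<gamma>
  proof -
    obtain \<beta> where \<beta>: "\<beta> > 0" "\<And>t. d t \<le> \<beta> * m t powr \<gamma>"
      using regular unfolding holder_regular_on_def d_def m_def S_def by blast
    show ?thesis
      by (rule Hoelder_descent_rate[of \<kappa> \<beta> \<gamma> d m, OF \<kappa> \<beta>(1) \<gamma> d0 m0 d_step \<beta>(2)])
  qed
  obtain \<gamma> where \<gamma>: "\<gamma> \<in> {0<..1}" "holder_regular_on (range x) C D \<gamma>"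
    using assms(10) bdd unfolding bounded_holder_regular_def by blast
  obtain \<rho> M where \<rho>: "\<rho> > 0" and M: "M > 0"
    and d_le: "\<And>t. t \<ge> 1 \<Longrightarrow> d t \<le> M * real t powr (- \<rho>)"
    using rate_imp_powr_rate[OF \<gamma>(1) rate[OF \<gamma>]] by blast
  have "(\<lambda>t. M * real t powr (- \<rho>)) \<longlonglongrightarrow> M * 0"
    by (intro tendsto_mult tendsto_const tendsto_neg_powr filterlim_real_sequentially) (use \<rho> in simp)
  then have upper: "(\<lambda>t. M * real t powr (- \<rho>)) \<longlonglongrightarrow> 0" by simp
  have "d \<longlonglongrightarrow> 0"
    by (rule tendsto_sandwich[OF _ _ tendsto_const upper])
      (use d0 d_le in \<open>auto intro: eventually_sequentiallyI[of 1]\<close>)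
  then have "(\<lambda>t. infdist (x t) S) \<longlonglongrightarrow> 0"
    by (simp add: d_def[abs_def])
  then obtain xbar where xbar: "xbar \<in> S" "x \<longlonglongrightarrow> xbar"
    and "\<And>t. dist (x t) xbar \<le> 2 * d t"
    unfolding d_def using Fejer_monotone_limit[of S x, OF S(1,3) fejer] by blast
  then have near: "norm (x t - xbar) \<le> 2 * d t" for t
    by (simp add: dist_norm)
  have "norm (x t - xbar) \<le> 2 * M * real t powr (- \<rho>)" if "t \<ge> 1" for t
    using near[of t] d_le[OF that] by simp
  then have "sublinear_rate x xbar \<rho>"
    unfolding sublinear_rate_def by blast
  \<comment> \<open>Here \<open>\<gamma>\<close> may differ from the exponent used to find
    \<open>xbar\<close>. The estimate \<open>near\<close> does not involve the exponent, so the rate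
    of \<open>d\<close> for the new \<open>\<gamma>\<close> transfers to the same limit with its
    constant doubled.\<close>
  moreover have "\<exists>M>0. \<exists>r\<in>{0<..<1}. \<forall>t\<ge>1. norm (x t - xbar) \<le>
      (if \<gamma> < 1 then M * real t powr (- (\<gamma> / (2 * (1 - \<gamma>)))) else M * r ^ t)"
    if unif: "bounded_holder_regular_uniform C D \<gamma>" for \<gamma>
  proof -
    obtain M r where M: "M > 0" and r: "r \<in> {0<..<1}" and b: "\<And>t. t \<ge> 1 \<Longrightarrow>
        d t \<le> (if \<gamma> < 1 then M * real t powr (- (\<gamma> / (2 * (1 - \<gamma>)))) else M * r ^ t)"
      using rate[of \<gamma>] unif bdd unfolding bounded_holder_regular_uniform_def by blast
    have "norm (x t - xbar) \<le>
        (if \<gamma> < 1 then 2 * M * real t powr (- (\<gamma> / (2 * (1 - \<gamma>)))) else 2 * M * r ^ t)"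
      if "t \<ge> 1" for t
      using near[of t] b[OF that] by (simp split: if_splits)
    moreover have "2 * M > 0" using M by simp
    ultimately show ?thesis using r by blast
  qed
  ultimately show ?thesis
    using xbar \<rho> unfolding S_def by blast
qed

end
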